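(* For every pair $(\pi,\ell)$ where $\pi\in(0,1]^d$ and where $\ell$ is a $d$-variate stable tail dependence function with $\ell(\pi)=1$, there exists a spectral random vector $S$, unique in distribution, such that $Z\sim\operatorname{GP}(\mathbf 1,\mathbf 0,\pi,\ell)$ can be represented in distribution as $$Z\overset{d}{=}S+E,$$ with $E$ a unit exponential random variable, independent of $S$.
   Context: Conventions: operations and order relations between vectors are componentwise, scalars being added to every component; $a\wedge b=\min(a,b)$; $e^{-\infty}=0$; $\mathbf 1=(1,\dots,1)$, $\mathbf 0=(0,\dots,0)$. A random vector $S$ with values in $[-\infty,0]^d$ is called a spectral random vector if (S1) $\Pr[\max(S_1,\dots,S_d)=0]=1$ and (S2) $\Pr[S_j>-\infty]>0$ for all $j=1,\dots,d$. A function $\ell:[0,\infty)^d\to[0,\infty)$ is a stable tail dependence function (stdf) if there is a random vector $V$ with values in $[0,\infty)^d$ and $\mathbb E[V_j]=1$ for all $j$ such that $\ell(y)=\mathbb E[\max_{j}(y_jV_j)]$ for all $y\in[0,\infty)^d$. For $\pi\in(0,1]^d$ and a stdf $\ell$ with $\ell(\pi)=1$, $\operatorname{GP}(\mathbf 1,\mathbf 0,\pi,\ell)$ is the (standardized multivariate generalized Pareto) probability distribution concentrated on $[-\infty,\infty)^d\setminus[-\infty,0]^d$ with cdf $H(z)=\ell(\pi e^{-(z\wedge 0)})-\ell(\pi e^{-z})$, $z\in\mathbb R^d$. *)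

theory Defs
  imports "HOL-Probability.Probability"
begin

text \<open>
  Vectors of dimension \<open>d \<ge> 1\<close> are functions on a finite index type \<open>'n\<close> with \<open>d\<close> elements, so that
  their sigma-algebra is the library's finite product of Borel sigma-algebras.
\<close>

abbreviation rvec :: "('n::finite \<Rightarrow> real) measure" where
  "rvec \<equiv> Pi\<^sub>M UNIV (\<lambda>_. borel)"

abbreviation evec :: "('n::finite \<Rightarrow> ereal) measure" where
  "evec \<equiv> Pi\<^sub>M UNIV (\<lambda>_. borel)"

text \<open>
  Only the values of \<open>l\<close> on nonnegative vectors matter. The sample space of \<open>V\<close> has the fixed type
  \<open>'n \<Rightarrow> real\<close> because HOL cannot quantify existentially over types; by lemma \<open>is_stdfI\<close> below
  this is no restriction.
\<close>

definition is_stdf :: "(('n::finite \<Rightarrow> real) \<Rightarrow> real) \<Rightarrow> bool" where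
  "is_stdf l \<longleftrightarrow>
     (\<exists>(M :: ('n \<Rightarrow> real) measure) (V :: ('n \<Rightarrow> real) \<Rightarrow> 'n \<Rightarrow> real).
        prob_space M \<and> V \<in> M \<rightarrow>\<^sub>M rvec \<and>
        (\<forall>\<omega>\<in>space M. \<forall>j. 0 \<le> V \<omega> j) \<and>
        (\<forall>j. has_bochner_integral M (\<lambda>\<omega>. V \<omega> j) 1) \<and>
        (\<forall>y. (\<forall>j. 0 \<le> y j) \<longrightarrow> l y = (\<integral>\<omega>. (MAX j. y j * V \<omega> j) \<partial>M)))"

lemma is_stdfI:
  fixes M :: "'a measure" and V :: "'a \<Rightarrow> 'n::finite \<Rightarrow> real"
  assumes M: "prob_space M" and V[measurable]: "V \<in> M \<rightarrow>\<^sub>M rvec"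
    and nonneg: "\<And>\<omega> j. \<omega> \<in> space M \<Longrightarrow> 0 \<le> V \<omega> j"
    and mean: "\<And>j. has_bochner_integral M (\<lambda>\<omega>. V \<omega> j) 1"
    and l: "\<And>y. (\<And>j. 0 \<le> y j) \<Longrightarrow> l y = (\<integral>\<omega>. (MAX j. y j * V \<omega> j) \<partial>M)"
  shows "is_stdf l"
proof -
  let ?N = "distr M rvec V"
  let ?W = "\<lambda>(v :: 'n \<Rightarrow> real) j. \<bar>v j\<bar>"
  interpret prob_space M by (rule M)
  have W[measurable]: "?W \<in> rvec \<rightarrow>\<^sub>M rvec"
    by (rule measurable_PiM_single') (auto simp: space_PiM)
  have Max_meas: "(\<lambda>v :: 'n \<Rightarrow> real. MAX j. y j * \<bar>v j\<bar>) \<in> borel_measurable rvec" for y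
    by measurable
  have "has_bochner_integral ?N (\<lambda>v. ?W v j) 1" for j
  proof -
    have "has_bochner_integral M (\<lambda>\<omega>. ?W (V \<omega>) j) 1"
      using mean[of j] nonneg by (subst has_bochner_integral_cong[OF refl, of _ _ "\<lambda>\<omega>. V \<omega> j" 1 1]) auto
    then show ?thesis
      by (intro has_bochner_integral_distr) auto
  qed
  moreover have "l y = (\<integral>v. (MAX j. y j * ?W v j) \<partial>?N)" if "\<forall>j. 0 \<le> y j" for y
  proof -
    have "(\<integral>v. (MAX j. y j * ?W v j) \<partial>?N) = (\<integral>\<omega>. (MAX j. y j * ?W (V \<omega>) j) \<partial>M)"
      by (rule integral_distr[OF V Max_meas])
    also have "\<dots> = (\<integral>\<omega>. (MAX j. y j * V \<omega> j) \<partial>M)"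
      using nonneg by (intro Bochner_Integration.integral_cong) auto
    finally show ?thesis using l[of y] that by simp
  qed
  ultimately show ?thesis
    unfolding is_stdf_def
    by (intro exI[of _ ?N] exI[of _ ?W]) (auto intro: prob_space_distr)
qed

definition spectral_random_vector :: "'a measure \<Rightarrow> ('a \<Rightarrow> 'n::finite \<Rightarrow> ereal) \<Rightarrow> bool" where
  "spectral_random_vector M S \<longleftrightarrow>
     prob_space M \<and> S \<in> M \<rightarrow>\<^sub>M evec \<and>
     (\<forall>\<omega>\<in>space M. \<forall>j. S \<omega> j \<le> 0) \<and>
     \<P>(\<omega> in M. (MAX j. S \<omega> j) = 0) = 1 \<and>
     (\<forall>j. \<P>(\<omega> in M. S \<omega> j > -\<infinity>) > 0)"

text \<open>
  \<open>is_GP p l \<mu>\<close>: the law \<open>\<mu>\<close> on the extended vectors is \<open>GP(1, 0, p, l)\<close>.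
\<close>

definition is_GP ::
    "('n::finite \<Rightarrow> real) \<Rightarrow> (('n \<Rightarrow> real) \<Rightarrow> real) \<Rightarrow> ('n \<Rightarrow> ereal) measure \<Rightarrow> bool" where
  "is_GP p l \<mu> \<longleftrightarrow>
     prob_space \<mu> \<and> sets \<mu> = sets evec \<and>
     (AE x in \<mu>. (\<forall>j. x j < \<infinity>) \<and> \<not> (\<forall>j. x j \<le> 0)) \<and>
     (\<forall>z :: 'n \<Rightarrow> real. \<P>(x in \<mu>. \<forall>j. x j \<le> ereal (z j)) =
        l (\<lambda>j. p j * exp (- min (z j) 0)) - l (\<lambda>j. p j * exp (- z j)))"

text \<open>
  A spectral random vector \<open>S\<close> and an independent unit exponential variable \<open>E\<close> on a common
  probability space. Independence is that of the sigma-algebras generated by \<open>S\<close> and \<open>E\<close>: the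
  library's \<open>indep_var\<close> requires both variables to have the same value type.
\<close>

definition spectral_exp_pair ::
    "'a measure \<Rightarrow> ('a \<Rightarrow> 'n::finite \<Rightarrow> ereal) \<Rightarrow> ('a \<Rightarrow> real) \<Rightarrow> bool" where
  "spectral_exp_pair M S E \<longleftrightarrow>
     spectral_random_vector M S \<and>
     distributed M lborel E (exponential_density 1) \<and>
     prob_space.indep_set M
       {S -` A \<inter> space M | A. A \<in> sets evec}
       {E -` B \<inter> space M | B. B \<in> sets borel}"

definition add_scalar :: "('n \<Rightarrow> ereal) \<Rightarrow> real \<Rightarrow> 'n \<Rightarrow> ereal" where
  "add_scalar s t = (\<lambda>j. s j + ereal t)"

end

theory Submission
  imports Defs
begin

text \<open>
  Suppose \<open>l y = E [max\<^sub>j y\<^sub>j V\<^sub>j]\<close>. Then \<open>R = max\<^sub>j p\<^sub>j V\<^sub>j\<close> has mean \<open>l p = 1\<close>. Under the probability with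
  density \<open>R\<close>, the vector \<open>S\<^sub>j = ln (p\<^sub>j V\<^sub>j / R)\<close> is spectral and \<open>l (p y) = E [max\<^sub>j y\<^sub>j e\<^bsup>S\<^sub>j\<^esup>]\<close>. With
  \<open>A = max\<^sub>j e\<^bsup>S\<^sub>j - z\<^sub>j\<^esup>\<close>, the event \<open>S + E \<le> z\<close> is \<open>A \<le> e\<^bsup>-E\<^esup>\<close>, of conditional probability
  \<open>max A 1 - A\<close>; since \<open>max S = 0\<close>, \<open>max A 1\<close> is \<open>A\<close> with \<open>z\<close> replaced by \<open>min z 0\<close>, and taking
  expectations yields the generalized Pareto distribution function. Conversely, this function
  determines the law of \<open>Z = S + E\<close>, and \<open>max S = 0\<close> gives \<open>max Z = E\<close>, so that \<open>S = Z - max Z\<close>.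
\<close>

section \<open>Laws on extended vectors and their distribution functions\<close>

text \<open>With extended bounds allowed, a half-space \<open>x i \<le> a\<close> is itself an
  orthant: every other bound is \<infinity>. Such half-spaces generate the product
  sigma-algebra.\<close>

lemma sets_evec_orthants:
  "sets (evec :: ('n::finite \<Rightarrow> ereal) measure) = sigma_sets UNIV (range (\<lambda>c. {x. \<forall>j. x j \<le> c j}))"
proof
  let ?G = "range (\<lambda>c :: 'n \<Rightarrow> ereal. {x. \<forall>j. x j \<le> c j})"
  let ?N = "sigma UNIV ?G"
  have "sets evec \<subseteq> sets ?N"
  proof (rule sets_PiM_in_sets)
    fix i :: 'n and A :: "ereal set" assume A: "A \<in> sets borel"
    have "(\<lambda>x. x i) \<in> borel_measurable ?N"
      unfolding borel_measurable_iff_Iic_ereal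
    proof
      fix a :: ereal
      have "(\<lambda>x. x i) -` {..a} \<inter> space ?N = {x. \<forall>j. x j \<le> (if j = i then a else \<infinity>)}"
        by (auto simp: space_measure_of_conv)
      then show "(\<lambda>x. x i) -` {..a} \<inter> space ?N \<in> sets ?N"
        by (auto intro!: sigma_sets.Basic)
    qed
    from measurable_sets[OF this A] show "{x \<in> space ?N. x i \<in> A} \<in> sets ?N"
      by (simp add: vimage_def Int_def conj_commute)
  qed (simp add: space_measure_of_conv)
  then show "sets evec \<subseteq> sigma_sets UNIV ?G" by simp
  have "?G \<subseteq> sets evec"
  proof safe
    fix c :: "'n \<Rightarrow> ereal"
    have "{x \<in> space evec. \<forall>j. x j \<le> c j} \<in> sets evec" by measurable
    then show "{x. \<forall>j. x j \<le> c j} \<in> sets evec" by (simp add: space_PiM)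
  qed
  then show "sigma_sets UNIV ?G \<subseteq> sets evec"
    using sets.sigma_sets_subset[of ?G evec] by (simp add: space_PiM)
qed

text \<open>Mass at \<open>\<infinity>\<close> must be excluded: real orthants do not see it.\<close>

lemma orthant_limit:
  fixes c :: "'n::finite \<Rightarrow> ereal"
  defines "z \<equiv> \<lambda>n j. if c j = \<infinity> then real n else if c j = - \<infinity> then - real n else real_of_ereal (c j)"
  assumes "prob_space \<mu>" and [measurable_cong]: "sets \<mu> = sets evec"
    and fin: "AE x in \<mu>. \<forall>j. x j < \<infinity>"
  shows "(\<lambda>n. \<P>(x in \<mu>. \<forall>j. x j \<le> ereal (z n j))) \<longlonglongrightarrow> \<P>(x in \<mu>. \<forall>j. x j \<le> c j)"
proof -
  interpret prob_space \<mu> by fact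
  let ?A = "\<lambda>n. {x \<in> space \<mu>. \<forall>j. x j \<le> ereal (z n j)}"
  let ?B = "{x \<in> space \<mu>. \<forall>j. x j \<le> c j}"
  \<comment> \<open>A real \<open>t\<close> eventually lies between \<open>- n\<close> and
    \<open>n\<close>, so infinite bounds are also decided correctly from some index on. At
    \<open>t = \<infinity>\<close> this fails for \<open>c j = \<infinity>\<close>.\<close>
  have coord: "\<forall>\<^sub>F n in sequentially. (t \<le> ereal (z n j)) = (t \<le> c j)" if "t < \<infinity>" for t j
  proof (cases t)
    case (real r)
    obtain N :: nat where N: "\<bar>r\<bar> < N" using reals_Archimedean2 by blast
    show ?thesis
      using eventually_ge_at_top[of N] by eventually_elim
        (use N in \<open>cases "c j"; auto simp: z_def real\<close>)
  qed (use that in auto)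
  \<comment> \<open>The events need not be monotone in \<open>n\<close>, since bounds may rise in
    some coordinates and fall in others; hence dominated convergence of indicators instead of
    continuity of the measure.\<close>
  have "(\<lambda>n. integral\<^sup>L \<mu> (indicator (?A n) :: _ \<Rightarrow> real)) \<longlonglongrightarrow> integral\<^sup>L \<mu> (indicator ?B)"
  proof (rule integral_dominated_convergence[where w = "\<lambda>_. 1"])
    show "AE x in \<mu>. (\<lambda>n. indicator (?A n) x :: real) \<longlonglongrightarrow> indicator ?B x"
      using fin
    proof eventually_elim
      case (elim x)
      have "\<forall>\<^sub>F n in sequentially. \<forall>j. (x j \<le> ereal (z n j)) = (x j \<le> c j)"
        using coord elim by (intro eventually_all_finite) auto
      then have "\<forall>\<^sub>F n in sequentially. (indicator (?A n) x :: real) = indicator ?B x"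
        by eventually_elim (auto simp: indicator_def)
      then show ?case by (rule tendsto_eventually)
    qed
  qed (auto simp: indicator_def)
  then show ?thesis by simp
qed

text \<open>Orthants with extended bounds form an intersection-stable generator. Agreement is given
  only for real bounds and passes to extended ones through \<open>orthant_limit\<close>.\<close>

lemma evec_eqI:
  fixes \<mu> \<mu>' :: "('n::finite \<Rightarrow> ereal) measure"
  assumes P: "prob_space \<mu>" "prob_space \<mu>'"
    and S[simp]: "sets \<mu> = sets evec" "sets \<mu>' = sets evec"
    and fin: "AE x in \<mu>. \<forall>j. x j < \<infinity>" "AE x in \<mu>'. \<forall>j. x j < \<infinity>"
    and eq: "\<And>z :: 'n \<Rightarrow> real. \<P>(x in \<mu>. \<forall>j. x j \<le> ereal (z j)) = \<P>(x in \<mu>'. \<forall>j. x j \<le> ereal (z j))"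
  shows "\<mu> = \<mu>'"
proof (rule measure_eqI_generator_eq[where \<Omega> = UNIV and A = "\<lambda>_. UNIV"])
  interpret M: prob_space \<mu> by fact
  interpret M': prob_space \<mu>' by fact
  let ?G = "range (\<lambda>c :: 'n \<Rightarrow> ereal. {x. \<forall>j. x j \<le> c j})"
  have space: "space \<mu> = UNIV" "space \<mu>' = UNIV"
    by (auto simp: sets_eq_imp_space_eq[OF S(1)] sets_eq_imp_space_eq[OF S(2)] space_PiM)
  show "Int_stable ?G"
  proof (rule Int_stableI_image)
    fix c c' :: "'n \<Rightarrow> ereal"
    show "\<exists>k\<in>UNIV. {x. \<forall>j. x j \<le> c j} \<inter> {x. \<forall>j. x j \<le> c' j} = {x. \<forall>j. x j \<le> k j}"
      by (intro bexI[of _ "\<lambda>j. min (c j) (c' j)"]) auto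
  qed
  show "sets \<mu> = sigma_sets UNIV ?G" "sets \<mu>' = sigma_sets UNIV ?G"
    by (simp_all add: sets_evec_orthants)
  show "emeasure \<mu> X = emeasure \<mu>' X" if "X \<in> ?G" for X
  proof -
    from that obtain c where X: "X = {x. \<forall>j. x j \<le> c j}" by auto
    have "\<P>(x in \<mu>. \<forall>j. x j \<le> c j) = \<P>(x in \<mu>'. \<forall>j. x j \<le> c j)"
      using orthant_limit[OF P(1) S(1) fin(1), of c] orthant_limit[OF P(2) S(2) fin(2), of c]
      unfolding eq by (rule LIMSEQ_unique)
    then show ?thesis by (simp add: X space M.emeasure_eq_measure M'.emeasure_eq_measure)
  qed
  \<comment> \<open>The whole space is an orthant, so a constant sequence exhausts it.\<close>
  have "{x. \<forall>j. x j \<le> top} \<in> ?G" by (rule range_eqI[of _ _ "\<lambda>_. top"]) simp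
  then show "range (\<lambda>_. UNIV) \<subseteq> ?G" by auto
  show "emeasure \<mu> UNIV \<noteq> \<infinity>" by (simp add: M.emeasure_eq_measure)
qed auto

lemma is_GP_unique:
  assumes "is_GP p l \<mu>" "is_GP p l \<mu>'"
  shows "\<mu> = \<mu>'"
  using assms unfolding is_GP_def by (intro evec_eqI) auto

section \<open>Maxima and shifts; recovering \<open>S\<close> from \<open>S + E\<close>\<close>

lemma Max_range_mult:
  fixes f :: "'n::finite \<Rightarrow> real"
  assumes "0 \<le> c"
  shows "c * (MAX j. f j) = (MAX j. c * f j)"
  using mono_Max_commute[of "\<lambda>x. c * x" "range f"] assms
  by (simp add: image_image mono_def mult_left_mono)

lemma measurable_add_scalar[measurable]:
  assumes [measurable]: "S \<in> M \<rightarrow>\<^sub>M evec" "E \<in> borel_measurable M"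
  shows "(\<lambda>\<omega>. add_scalar (S \<omega>) (E \<omega>)) \<in> M \<rightarrow>\<^sub>M evec"
  unfolding add_scalar_def by (rule measurable_PiM_single') (auto simp: space_PiM)

text \<open>Adding \<open>E\<close> moves the maximum from 0 to \<open>E\<close> almost surely, so
  subtracting the maximum of the sum restores \<open>S\<close>. Thus one fixed measurable map
  carries the law of the sum to that of \<open>S\<close>, which reduces uniqueness for
  \<open>S\<close> to uniqueness of the law of the sum.\<close>

lemma distr_spectral:
  fixes S :: "'a \<Rightarrow> 'n::finite \<Rightarrow> ereal"
  assumes "spectral_exp_pair M S E"
  shows "distr M evec S =
    distr (distr M evec (\<lambda>\<omega>. add_scalar (S \<omega>) (E \<omega>))) evec (\<lambda>x j. x j - (MAX i. x i))"
proof -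
  from assms have "prob_space M" and S[measurable]: "S \<in> M \<rightarrow>\<^sub>M evec"
    and max: "\<P>(\<omega> in M. (MAX j. S \<omega> j) = 0) = 1"
    and "distributed M lborel E (exponential_density 1)"
    by (auto simp: spectral_exp_pair_def spectral_random_vector_def)
  then have E[measurable]: "E \<in> borel_measurable M" by (auto simp: distributed_def)
  interpret prob_space M by fact
  have T[measurable]: "(\<lambda>x j. x j - (MAX i. x i)) \<in> evec \<rightarrow>\<^sub>M (evec :: ('n \<Rightarrow> ereal) measure)"
    by (rule measurable_PiM_single') (auto simp: space_PiM)
  have "AE \<omega> in M. (MAX j. S \<omega> j) = 0"
    using max by (subst (asm) prob_Collect_eq_1) auto
  then have "AE \<omega> in M. S \<omega> = (\<lambda>j. add_scalar (S \<omega>) (E \<omega>) j - (MAX i. add_scalar (S \<omega>) (E \<omega>) i))"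
  proof eventually_elim
    case (elim \<omega>)
    have "(MAX i. S \<omega> i + ereal (E \<omega>)) = (MAX i. S \<omega> i) + ereal (E \<omega>)"
      using mono_Max_commute[of "\<lambda>x. x + ereal (E \<omega>)" "range (S \<omega>)"]
      by (simp add: image_image mono_def add_right_mono)
    moreover have "s = s + ereal t - ereal t" for s t by (cases s) auto
    ultimately show ?case by (simp add: elim add_scalar_def)
  qed
  then show ?thesis
    by (subst distr_distr) (auto intro!: distr_cong_AE simp: comp_def)
qed

section \<open>Law of a spectral vector plus an independent exponential variable\<close>

text \<open>The case \<open>- \<infinity>\<close> is separate because \<open>real_of_ereal\<close>
  sends it to 0, which would give the value 1.\<close>

definition exp_ereal :: "ereal \<Rightarrow> real" where
  "exp_ereal s = (if s = - \<infinity> then 0 else exp (real_of_ereal s))"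

lemma exp_ereal_nonneg[simp]: "0 \<le> exp_ereal s"
  by (simp add: exp_ereal_def)

lemma exp_ereal_0[simp]: "exp_ereal 0 = 1"
  by (simp add: exp_ereal_def)

lemma exp_ereal_le_1: "s \<le> 0 \<Longrightarrow> exp_ereal s \<le> 1"
  by (cases s) (auto simp: exp_ereal_def)

lemma measurable_exp_ereal[measurable]: "exp_ereal \<in> borel_measurable borel"
  unfolding exp_ereal_def by measurable

text \<open>Exponentiation turns the constraints of all coordinates into comparisons with the same
  number \<open>exp (- t)\<close>, hence into one bound on a maximum. For
  \<open>s = - \<infinity>\<close> both sides are true.\<close>

lemma add_le_iff_exp_ereal:
  assumes "s \<le> 0"
  shows "s + ereal t \<le> ereal z \<longleftrightarrow> exp (- z) * exp_ereal s \<le> exp (- t)"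
proof (cases s)
  case (real r)
  have "exp (- z) * exp r \<le> exp (- t) \<longleftrightarrow> r + t \<le> z"
    by (subst exp_add[symmetric]) auto
  then show ?thesis by (simp add: real exp_ereal_def)
qed (use assms in \<open>auto simp: exp_ereal_def\<close>)

text \<open>Under the unit exponential law \<open>exp (- t)\<close> is uniform on (0, 1]; the
  formula merges the value \<open>1 - a\<close> for \<open>a \<le> 1\<close> with 0 for larger
  \<open>a\<close>.\<close>

lemma measure_exponential_le:
  assumes "0 < a"
  shows "measure (density lborel (exponential_density 1)) {t. a \<le> exp (- t)} = max a 1 - a"
proof -
  let ?D = "density lborel (exponential_density 1)"
  interpret prob_space ?D by (rule prob_space_exponential_density) simp
  have D: "distributed ?D lborel (\<lambda>t. t) (exponential_density 1)"
    by (auto simp: distributed_def distr_id2)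
  have iff: "a \<le> exp (- t) \<longleftrightarrow> t \<le> - ln a" for t
    using assms ln_le_cancel_iff[of a "exp (- t)"] by auto
  show ?thesis
  proof (cases "a \<le> 1")
    case True
    then show ?thesis
      using assms exponential_distributedD_le[OF D, of "- ln a"] by (simp add: iff)
  next
    case False
    have "0 \<le> ln a" using False by simp
    then have "prob {t. t \<le> - ln a} \<le> prob {t. t \<le> 0}"
      by (intro finite_measure_mono) auto
    also have "\<dots> = 0"
      using exponential_distributedD_le[OF D, of 0] by simp
    finally show ?thesis using False by (simp add: iff measure_le_0_iff)
  qed
qed

text \<open>The sum uses the truncated vector, which is nonpositive everywhere; where the maximum is
  0, truncation changes nothing.\<close>

lemma is_GP_add_exponential:
  fixes \<nu> :: "('n::finite \<Rightarrow> ereal) measure"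
  assumes \<nu>: "prob_space \<nu>" and [measurable_cong]: "sets \<nu> = sets evec"
    and max: "AE s in \<nu>. (MAX j. s j) = 0"
    and p: "\<And>j. 0 < p j"
    and l: "\<And>y. (\<And>j. 0 \<le> y j) \<Longrightarrow> l (\<lambda>j. p j * y j) = (\<integral>s. (MAX j. y j * exp_ereal (s j)) \<partial>\<nu>)"
  shows "is_GP p l (distr (\<nu> \<Otimes>\<^sub>M density lborel (exponential_density 1)) evec
    (\<lambda>\<omega>. add_scalar (\<lambda>j. min (fst \<omega> j) 0) (snd \<omega>)))"
proof -
  define D where "D = density lborel (exponential_density 1)"
  have [measurable_cong]: "sets D = sets borel" and [simp]: "space D = UNIV" by (simp_all add: D_def)
  interpret N: prob_space \<nu> by fact
  interpret D: prob_space D unfolding D_def by (rule prob_space_exponential_density) simp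
  interpret P: pair_prob_space \<nu> D ..
  let ?f = "\<lambda>\<omega> :: ('n \<Rightarrow> ereal) \<times> real. add_scalar (\<lambda>j. min (fst \<omega> j) 0) (snd \<omega>)"
  have [simp]: "space \<nu> = UNIV" using sets_eq_imp_space_eq[OF assms(2)] by (simp add: space_PiM)
  have clip[measurable]: "(\<lambda>\<omega> j. min (fst \<omega> j) 0) \<in> \<nu> \<Otimes>\<^sub>M D \<rightarrow>\<^sub>M (evec :: ('n \<Rightarrow> ereal) measure)"
    by (rule measurable_PiM_single') (auto simp: space_PiM)
  have f[measurable]: "?f \<in> \<nu> \<Otimes>\<^sub>M D \<rightarrow>\<^sub>M evec"
    using measurable_add_scalar[OF clip, of snd] by simp
  have le0: "s i \<le> 0" if "(MAX j. s j) = 0" for s :: "'n \<Rightarrow> ereal" and i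
    using Max_ge[of "range s" "s i"] that by simp
  \<comment> \<open>The density is positive at 0, so that point is discarded as a Lebesgue null set.
    Strict positivity makes the sum positive in a coordinate where \<open>s i = 0\<close>.\<close>
  have "AE t in D. 0 < t"
    unfolding D_def using AE_lborel_singleton[of "0 :: real"]
    by (subst AE_density) (auto simp: exponential_density_def elim!: eventually_mono)
  then have pos: "AE \<omega> in \<nu> \<Otimes>\<^sub>M D. 0 < snd \<omega>"
    by (intro P.AE_pair_measure) auto
  have "AE \<omega> in \<nu> \<Otimes>\<^sub>M D. (MAX j. fst \<omega> j) = 0"
    using max by (intro P.AE_pair_measure) (auto simp: measurable_split_conv)
  with pos have AE: "AE \<omega> in \<nu> \<Otimes>\<^sub>M D. (\<forall>j. ?f \<omega> j < \<infinity>) \<and> \<not> (\<forall>j. ?f \<omega> j \<le> 0)"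
  proof eventually_elim
    case (elim \<omega>)
    obtain s t where [simp]: "\<omega> = (s, t)" by fastforce
    have "0 \<in> range s" using elim Max_in[of "range s"] by simp
    then obtain i where i: "s i = 0" by auto
    have "min (s j) 0 + ereal t < \<infinity>" for j by (cases "s j") (auto simp: min_def)
    with i elim show ?case by (auto simp: add_scalar_def not_le intro!: exI[of _ i])
  qed
  have cdf: "P.prob {\<omega>. \<forall>j. ?f \<omega> j \<le> ereal (z j)}
      = l (\<lambda>j. p j * exp (- min (z j) 0)) - l (\<lambda>j. p j * exp (- z j))" for z
  proof -
    let ?a = "\<lambda>s. MAX j. exp (- z j) * exp_ereal (s j)"
    let ?b = "\<lambda>s. MAX j. exp (- min (z j) 0) * exp_ereal (s j)"
    have int: "integrable \<nu> (\<lambda>s. MAX j. c j * exp_ereal (s j))" if c: "\<And>j. 0 \<le> c j" for c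
    proof (rule N.integrable_const_bound[where B = "MAX j. c j"])
      show "AE s in \<nu>. norm (MAX j. c j * exp_ereal (s j)) \<le> (MAX j. c j)"
        using max
      proof eventually_elim
        case (elim s)
        have "c i * exp_ereal (s i) \<le> (MAX j. c j)" for i
        proof -
          have "c i * exp_ereal (s i) \<le> c i * 1"
            using c le0[OF elim] by (intro mult_left_mono exp_ereal_le_1) auto
          also have "\<dots> \<le> (MAX j. c j)" by simp
          finally show ?thesis .
        qed
        moreover have "0 \<le> (MAX j. c j * exp_ereal (s j))"
          using c by (subst Max_ge_iff) auto
        ultimately show ?case by simp
      qed
    qed measurable
    \<comment> \<open>Replacing \<open>z j > 0\<close> by 0 gives a term at most 1, and other terms
      stay the same. Conversely, a coordinate with \<open>s i = 0\<close> contributes at least 1 to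
      \<open>?b s\<close>.\<close>
    have b: "?b s = max (?a s) 1" if max: "(MAX j. s j) = 0" for s
    proof (rule antisym)
      have "0 \<in> range s" using max Max_in[of "range s"] by simp
      then obtain i where i: "s i = 0" by auto
      have "exp (- min (z j) 0) * exp_ereal (s j) \<le> max (?a s) 1" for j
      proof (cases "z j \<le> 0")
        case True
        then show ?thesis by (simp add: min_absorb1 le_max_iff_disj)
      next
        case False
        then show ?thesis using le0[OF max] by (simp add: min_absorb2 le_max_iff_disj exp_ereal_le_1)
      qed
      then show "?b s \<le> max (?a s) 1" by simp
      have "exp (- z j) * exp_ereal (s j) \<le> ?b s" for j
      proof -
        have "exp (- z j) * exp_ereal (s j) \<le> exp (- min (z j) 0) * exp_ereal (s j)"
          by (intro mult_right_mono) auto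
        also have "\<dots> \<le> ?b s" by simp
        finally show ?thesis .
      qed
      moreover have "1 \<le> ?b s"
        using i by (subst Max_ge_iff) (auto intro!: exI[of _ i])
      ultimately show "max (?a s) 1 \<le> ?b s" by simp
    qed
    \<comment> \<open>Fubini: condition on the spectral vector and measure the section in the
      exponential variable.\<close>
    have "P.prob {\<omega>. \<forall>j. ?f \<omega> j \<le> ereal (z j)} =
        enn2real (\<integral>\<^sup>+ s. emeasure D {t. \<forall>j. ?f (s, t) j \<le> ereal (z j)} \<partial>\<nu>)"
    proof -
      have "{\<omega> \<in> space (\<nu> \<Otimes>\<^sub>M D). \<forall>j. ?f \<omega> j \<le> ereal (z j)} \<in> sets (\<nu> \<Otimes>\<^sub>M D)"
        by measurable
      then have "{\<omega>. \<forall>j. ?f \<omega> j \<le> ereal (z j)} \<in> sets (\<nu> \<Otimes>\<^sub>M D)"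
        by (simp add: space_pair_measure)
      then show ?thesis
        unfolding measure_def by (subst D.emeasure_pair_measure_alt) (auto simp: vimage_def)
    qed
    also have "(\<integral>\<^sup>+ s. emeasure D {t. \<forall>j. ?f (s, t) j \<le> ereal (z j)} \<partial>\<nu>)
        = (\<integral>\<^sup>+ s. ennreal (?b s - ?a s) \<partial>\<nu>)"
    proof (rule nn_integral_cong_AE, use max in eventually_elim)
      case (elim s)
      have "0 \<in> range s" using elim Max_in[of "range s"] by simp
      then obtain i where i: "s i = 0" by auto
      have "0 < ?a s" using i by (subst Max_gr_iff) (auto intro!: exI[of _ i])
      have "(\<forall>j. ?f (s, t) j \<le> ereal (z j)) \<longleftrightarrow> ?a s \<le> exp (- t)" for t
        using le0[OF elim] by (simp add: add_scalar_def min_absorb1 add_le_iff_exp_ereal)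
      then have "emeasure D {t. \<forall>j. ?f (s, t) j \<le> ereal (z j)} = ennreal (max (?a s) 1 - ?a s)"
        using measure_exponential_le[OF \<open>0 < ?a s\<close>]
        by (simp only: D.emeasure_eq_measure D_def[symmetric])
      moreover have "max (?a s) 1 = ?b s" using b[OF elim] by simp
      ultimately show ?case by simp
    qed
    also have "enn2real \<dots> = (\<integral>s. ?b s - ?a s \<partial>\<nu>)"
    proof (rule integral_eq_nn_integral[symmetric])
      show "AE s in \<nu>. 0 \<le> ?b s - ?a s"
        using max by eventually_elim (simp only: b diff_ge_0_iff_ge max.cobounded1)
    qed measurable
    also have "\<dots> = (\<integral>s. ?b s \<partial>\<nu>) - (\<integral>s. ?a s \<partial>\<nu>)"
      by (intro Bochner_Integration.integral_diff int) auto
    also have "\<dots> = l (\<lambda>j. p j * exp (- min (z j) 0)) - l (\<lambda>j. p j * exp (- z j))"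
      by (simp add: l)
    finally show ?thesis .
  qed
  show ?thesis
    unfolding is_GP_def D_def[symmetric]
  proof (intro conjI allI)
    show "prob_space (distr (\<nu> \<Otimes>\<^sub>M D) evec ?f)" by (rule P.prob_space_distr) measurable
    show "AE x in distr (\<nu> \<Otimes>\<^sub>M D) evec ?f. (\<forall>j. x j < \<infinity>) \<and> \<not> (\<forall>j. x j \<le> 0)"
      using AE by (subst AE_distr_iff) auto
    fix z :: "'n \<Rightarrow> real"
    have "{x \<in> space evec. \<forall>j. x j \<le> ereal (z j)} \<in> sets evec" by measurable
    then have "{x :: 'n \<Rightarrow> ereal. \<forall>j. x j \<le> ereal (z j)} \<in> sets evec" by (simp add: space_PiM)
    then show "\<P>(x in distr (\<nu> \<Otimes>\<^sub>M D) evec ?f. \<forall>j. x j \<le> ereal (z j)) =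
        l (\<lambda>j. p j * exp (- min (z j) 0)) - l (\<lambda>j. p j * exp (- z j))"
      by (subst measure_distr) (auto simp: cdf[symmetric] space_pair_measure space_PiM vimage_def intro!: arg_cong[where f = P.prob])
  qed simp
qed

section \<open>Spectral law of a stable tail dependence function, by change of measure\<close>

lemma stdf_spectral_law:
  fixes p :: "'n::finite \<Rightarrow> real"
  assumes p: "\<And>j. 0 < p j" and "is_stdf l" and lp: "l p = 1"
  obtains \<nu> :: "('n \<Rightarrow> ereal) measure" where
    "prob_space \<nu>" "sets \<nu> = sets evec" "AE s in \<nu>. (MAX j. s j) = 0"
    "\<And>j. \<P>(s in \<nu>. s j > -\<infinity>) > 0"
    "\<And>y. (\<And>j. 0 \<le> y j) \<Longrightarrow> l (\<lambda>j. p j * y j) = (\<integral>s. (MAX j. y j * exp_ereal (s j)) \<partial>\<nu>)"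
proof -
  from \<open>is_stdf l\<close> obtain M :: "('n \<Rightarrow> real) measure" and V :: "('n \<Rightarrow> real) \<Rightarrow> 'n \<Rightarrow> real" where
    "prob_space M" and V[measurable]: "V \<in> M \<rightarrow>\<^sub>M rvec"
    and V0: "\<And>\<omega> j. \<omega> \<in> space M \<Longrightarrow> 0 \<le> V \<omega> j"
    and mean: "\<And>j. has_bochner_integral M (\<lambda>\<omega>. V \<omega> j) 1"
    and l: "\<And>y. (\<And>j. 0 \<le> y j) \<Longrightarrow> l y = (\<integral>\<omega>. (MAX j. y j * V \<omega> j) \<partial>M)"
    unfolding is_stdf_def by blast
  interpret prob_space M by fact
  define R where "R \<omega> = (MAX j. p j * V \<omega> j)" for \<omega>
  \<comment> \<open>The second case encodes ln 0. Points with \<open>R \<omega> = 0\<close> carry no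
    mass under the density \<open>R\<close>, so the quotient there is harmless.\<close>
  define T where "T \<omega> = (\<lambda>j. if 0 < V \<omega> j then ereal (ln (p j * V \<omega> j / R \<omega>)) else - \<infinity>)" for \<omega>
  define D where "D = density M (\<lambda>\<omega>. ennreal (R \<omega>))"
  define \<nu> where "\<nu> = distr D evec T"
  have R[measurable]: "R \<in> borel_measurable M" unfolding R_def by measurable
  have [measurable_cong]: "sets D = sets M" and [simp]: "space D = space M" by (simp_all add: D_def)
  have T[measurable]: "T \<in> M \<rightarrow>\<^sub>M evec"
    unfolding T_def by (rule measurable_PiM_single') (auto simp: space_PiM)
  have le_R: "p j * V \<omega> j \<le> R \<omega>" for j \<omega> by (simp add: R_def)
  have R0: "0 \<le> R \<omega>" if "\<omega> \<in> space M" for \<omega>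
  proof -
    have "0 \<le> p undefined * V \<omega> undefined" using p[of undefined] V0[OF that] by simp
    also have "\<dots> \<le> R \<omega>" by (rule le_R)
    finally show ?thesis .
  qed
  have "(\<integral>\<omega>. R \<omega> \<partial>M) = 1" using l[of p] p lp by (simp add: R_def less_imp_le)
  \<comment> \<open>A nonintegrable function has integral 0 by default, so the value 1 forces
    integrability.\<close>
  moreover from this have "integrable M R" using not_integrable_integral_eq[of M R] by auto
  ultimately have "(\<integral>\<^sup>+\<omega>. R \<omega> \<partial>M) = 1"
    using R0 by (subst nn_integral_eq_integral) auto
  then interpret D: prob_space D
    by (intro prob_spaceI) (simp add: D_def emeasure_density cong: nn_integral_cong)
  have AE_D: "(AE \<omega> in D. P \<omega>) \<longleftrightarrow> (AE \<omega> in M. 0 < R \<omega> \<longrightarrow> P \<omega>)" for P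
    unfolding D_def by (subst AE_density) auto
  have T_le: "T \<omega> j \<le> 0" if "\<omega> \<in> space M" "0 < R \<omega>" for \<omega> j
    using that p[of j] le_R[of j \<omega>] by (auto simp: T_def)
  have maxT: "(MAX j. T \<omega> j) = 0" if "\<omega> \<in> space M" "0 < R \<omega>" for \<omega>
  proof (rule Max_eqI)
    \<comment> \<open>At an index attaining \<open>R \<omega>\<close> the quotient is 1 and its
      logarithm 0.\<close>
    have "R \<omega> \<in> range (\<lambda>j. p j * V \<omega> j)" unfolding R_def by (rule Max_in) auto
    then obtain i where i: "R \<omega> = p i * V \<omega> i" by auto
    then have "0 < V \<omega> i" using that p[of i] by (simp add: zero_less_mult_iff)
    then have "T \<omega> i = 0" using that by (simp add: T_def i[symmetric])
    then show "0 \<in> range (T \<omega>)" by (metis rangeI)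
  qed (use T_le that in auto)
  show thesis
  proof (rule that[of \<nu>])
    show "prob_space \<nu>" unfolding \<nu>_def by (rule D.prob_space_distr) measurable
    show "sets \<nu> = sets evec" by (simp add: \<nu>_def)
    show "AE s in \<nu>. (MAX j. s j) = 0"
      unfolding \<nu>_def using maxT by (subst AE_distr_iff) (auto simp: AE_D)
    \<comment> \<open>Otherwise \<open>V \<omega> j = 0\<close> almost everywhere already under
      \<open>M\<close>: where it is positive, so is \<open>R\<close>, and the change of measure
      hides no such point. This contradicts mean 1.\<close>
    show "\<P>(s in \<nu>. s j > -\<infinity>) > 0" for j
    proof (rule ccontr)
      have "{s \<in> space evec. s j > -\<infinity>} \<in> sets evec" by measurable
      then have ev: "{s. s j \<noteq> -\<infinity>} \<in> sets evec" by (simp add: space_PiM)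
      assume "\<not> ?thesis"
      then have "\<P>(s in \<nu>. s j > -\<infinity>) = 0" by (simp add: not_less measure_le_0_iff)
      then have "D.prob {\<omega> \<in> space D. T \<omega> j > -\<infinity>} = 0"
        unfolding \<nu>_def by (subst (asm) measure_distr) (auto simp: space_PiM vimage_def Int_def conj_commute ev)
      then have "AE \<omega> in D. \<not> T \<omega> j > -\<infinity>"
        by (rule D.prob_Collect_eq_0[THEN iffD1, rotated]) measurable
      then have "AE \<omega> in M. V \<omega> j = 0"
        unfolding AE_D
      proof (rule AE_mp[OF _ AE_I2], intro impI)
        fix \<omega> assume \<omega>: "\<omega> \<in> space M" "0 < R \<omega> \<longrightarrow> \<not> T \<omega> j > -\<infinity>"
        have "\<not> 0 < V \<omega> j"
        proof
          assume "0 < V \<omega> j"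
          moreover from this have "0 < R \<omega>"
            using less_le_trans[OF mult_pos_pos[OF p] le_R] by blast
          ultimately show False using \<omega> by (simp add: T_def)
        qed
        then show "V \<omega> j = 0" using V0[OF \<omega>(1), of j] by simp
      qed
      then have "(\<integral>\<omega>. V \<omega> j \<partial>M) = 0" by (rule integral_eq_zero_AE)
      then show False using has_bochner_integral_integral_eq[OF mean[of j]] by simp
    qed
    show "l (\<lambda>j. p j * y j) = (\<integral>s. (MAX j. y j * exp_ereal (s j)) \<partial>\<nu>)" if y: "\<And>j. 0 \<le> y j" for y
    proof -
      have "(\<integral>s. (MAX j. y j * exp_ereal (s j)) \<partial>\<nu>) = (\<integral>\<omega>. (MAX j. y j * exp_ereal (T \<omega> j)) \<partial>D)"
        unfolding \<nu>_def by (rule integral_distr) measurable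
      also have "\<dots> = (\<integral>\<omega>. R \<omega> * (MAX j. y j * exp_ereal (T \<omega> j)) \<partial>M)"
        unfolding D_def using R0 by (intro integral_real_density) auto
      also have "\<dots> = (\<integral>\<omega>. (MAX j. p j * y j * V \<omega> j) \<partial>M)"
      proof (rule Bochner_Integration.integral_cong[OF refl])
        fix \<omega> assume \<omega>: "\<omega> \<in> space M"
        \<comment> \<open>The density cancels the denominator in \<open>T\<close>; for
          \<open>V \<omega> j = 0\<close> both sides vanish.\<close>
        have "R \<omega> * (y j * exp_ereal (T \<omega> j)) = p j * y j * V \<omega> j" for j
        proof (cases "0 < V \<omega> j")
          case True
          then have "0 < p j * V \<omega> j" using p[of j] by simp
          with le_R[of j \<omega>] have "0 < R \<omega>" by linarith
          with True p[of j] show ?thesis by (simp add: T_def exp_ereal_def)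
        next
          case False
          then show ?thesis using V0[OF \<omega>, of j] by (simp add: T_def exp_ereal_def)
        qed
        then show "R \<omega> * (MAX j. y j * exp_ereal (T \<omega> j)) = (MAX j. p j * y j * V \<omega> j)"
          by (simp only: Max_range_mult[OF R0[OF \<omega>]])
      qed
      also have "\<dots> = l (\<lambda>j. p j * y j)"
        using y p[THEN less_imp_le] by (intro l[symmetric] mult_nonneg_nonneg)
      finally show ?thesis ..
    qed
  qed
qed

section \<open>Realization on a product space and conclusion\<close>

text \<open>
  Truncating at 0 changes \<open>fst\<close> only on a null set; it is needed because the nonpositivity in
  \<^const>\<open>spectral_random_vector\<close> is required at every sample point.
\<close>

lemma spectral_exp_pair_product:
  fixes \<nu> :: "('n::finite \<Rightarrow> ereal) measure"
  assumes \<nu>: "prob_space \<nu>" and [measurable_cong]: "sets \<nu> = sets evec"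
    and max: "AE s in \<nu>. (MAX j. s j) = 0" and pos: "\<And>j. \<P>(s in \<nu>. s j > -\<infinity>) > 0"
  shows "spectral_exp_pair (\<nu> \<Otimes>\<^sub>M density lborel (exponential_density 1)) (\<lambda>\<omega> j. min (fst \<omega> j) 0) snd"
proof -
  define D where "D = density lborel (exponential_density 1)"
  have [measurable_cong]: "sets D = sets borel" and [simp]: "space D = UNIV" by (simp_all add: D_def)
  interpret N: prob_space \<nu> by fact
  interpret D: prob_space D unfolding D_def by (rule prob_space_exponential_density) simp
  interpret P: pair_prob_space \<nu> D ..
  let ?c = "\<lambda>(s :: 'n \<Rightarrow> ereal) j. min (s j) 0"
  let ?S = "\<lambda>\<omega> :: ('n \<Rightarrow> ereal) \<times> real. ?c (fst \<omega>)"
  have [simp]: "space \<nu> = UNIV" using sets_eq_imp_space_eq[OF assms(2)] by (simp add: space_PiM)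
  have c[measurable]: "?c \<in> \<nu> \<rightarrow>\<^sub>M evec"
    by (rule measurable_PiM_single') (auto simp: space_PiM)
  have S[measurable]: "?S \<in> \<nu> \<Otimes>\<^sub>M D \<rightarrow>\<^sub>M evec" by measurable
  have prob_Times: "P.prob (A \<times> B) = N.prob A * D.prob B" if "A \<in> sets \<nu>" "B \<in> sets D" for A B
    using that by (simp add: measure_def D.emeasure_pair_measure_Times enn2real_mult)
  have "AE \<omega> in \<nu> \<Otimes>\<^sub>M D. (MAX j. fst \<omega> j) = 0"
    using max by (intro P.AE_pair_measure) (auto simp: measurable_split_conv)
  then have "AE \<omega> in \<nu> \<Otimes>\<^sub>M D. (MAX j. ?S \<omega> j) = 0"
  proof eventually_elim
    case (elim \<omega>)
    have "fst \<omega> j \<le> 0" for j using Max_ge[of "range (fst \<omega>)" "fst \<omega> j"] elim by simp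
    then show ?case using elim by (simp add: min_absorb1)
  qed
  then have max': "\<P>(\<omega> in \<nu> \<Otimes>\<^sub>M D. (MAX j. ?S \<omega> j) = 0) = 1"
    by (subst P.prob_Collect_eq_1) auto
  have pos': "\<P>(\<omega> in \<nu> \<Otimes>\<^sub>M D. ?S \<omega> j > -\<infinity>) > 0" for j
  proof -
    have "{s \<in> space \<nu>. s j > -\<infinity>} \<in> sets \<nu>" by measurable
    then have "P.prob ({s. s j > -\<infinity>} \<times> UNIV) = \<P>(s in \<nu>. s j > -\<infinity>)"
      using D.prob_space by (subst prob_Times) (auto simp: sets_eq_imp_space_eq)
    moreover have "{\<omega> \<in> space (\<nu> \<Otimes>\<^sub>M D). ?S \<omega> j > -\<infinity>} = {s. s j > -\<infinity>} \<times> UNIV"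
      by (auto simp: space_pair_measure)
    ultimately show ?thesis using pos[of j] by simp
  qed
  have "distr (\<nu> \<Otimes>\<^sub>M D) lborel snd = D"
  proof (rule measure_eqI)
    fix A assume "A \<in> sets (distr (\<nu> \<Otimes>\<^sub>M D) lborel snd)"
    then have A: "A \<in> sets D" "A \<in> sets borel" by (simp_all add: D_def)
    have "snd -` A \<inter> space (\<nu> \<Otimes>\<^sub>M D) = UNIV \<times> A" by (auto simp: space_pair_measure)
    then show "emeasure (distr (\<nu> \<Otimes>\<^sub>M D) lborel snd) A = emeasure D A"
      using A N.emeasure_space_1 sets.top[of \<nu>]
      by (subst emeasure_distr) (auto simp: D.emeasure_pair_measure_Times D_def[symmetric])
  qed (simp add: D_def)
  then have E: "distributed (\<nu> \<Otimes>\<^sub>M D) lborel snd (exponential_density 1)"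
    by (simp add: distributed_def D_def)
  have "P.indep_set {?S -` A \<inter> space (\<nu> \<Otimes>\<^sub>M D) | A. A \<in> sets evec} {snd -` B \<inter> space (\<nu> \<Otimes>\<^sub>M D) | B. B \<in> sets borel}"
  proof (rule P.indep_setI)
    show "{?S -` A \<inter> space (\<nu> \<Otimes>\<^sub>M D) | A. A \<in> sets evec} \<subseteq> P.events"
      using measurable_sets[OF S] by auto
    show "{snd -` B \<inter> space (\<nu> \<Otimes>\<^sub>M D) | B. B \<in> sets borel} \<subseteq> P.events"
      using measurable_sets[OF measurable_snd[of \<nu> D]] by (auto simp: D_def)
    fix a b assume "a \<in> {?S -` A \<inter> space (\<nu> \<Otimes>\<^sub>M D) | A. A \<in> sets evec}" "b \<in> {snd -` B \<inter> space (\<nu> \<Otimes>\<^sub>M D) | B. B \<in> sets borel}"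
    then obtain A B where A: "A \<in> sets evec" and B: "B \<in> sets D"
      and "a = ?S -` A \<inter> space (\<nu> \<Otimes>\<^sub>M D)" "b = snd -` B \<inter> space (\<nu> \<Otimes>\<^sub>M D)"
      by (auto simp: D_def)
    \<comment> \<open>Events of the two variables are cylinders over different factors, so they meet
      in a rectangle.\<close>
    then have ab: "a = (?c -` A) \<times> UNIV" "b = UNIV \<times> B" "a \<inter> b = (?c -` A) \<times> B"
      by (auto simp: space_pair_measure)
    have "?c -` A \<in> sets \<nu>" using measurable_sets[OF c A] by simp
    then show "P.prob (a \<inter> b) = P.prob a * P.prob b"
      using B N.prob_space D.prob_space sets.top[of \<nu>] sets.top[of D]
      \<comment> \<open>The intersection is rewritten first, before \<open>a\<close> and
        \<open>b\<close> are expanded inside it.\<close>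
      unfolding ab(3) unfolding ab(1,2) by (simp add: prob_Times)
  qed
  with max' pos' E show ?thesis
    unfolding spectral_exp_pair_def spectral_random_vector_def D_def[symmetric]
    using P.prob_space_axioms S by auto
qed

theorem theorem4p4:
  fixes p :: "'n::finite \<Rightarrow> real" and l :: "('n \<Rightarrow> real) \<Rightarrow> real"
  assumes "\<And>j. 0 < p j \<and> p j \<le> 1"
    and "is_stdf l"
    and "l p = 1"
  shows "\<exists>\<nu> :: ('n \<Rightarrow> ereal) measure.
      (\<exists>(M :: (('n \<Rightarrow> ereal) \<times> real) measure) S E.
          spectral_exp_pair M S E \<and> distr M evec S = \<nu> \<and>
          is_GP p l (distr M evec (\<lambda>\<omega>. add_scalar (S \<omega>) (E \<omega>))) \<and>
          (\<forall>(N :: 'b measure) Z. prob_space N \<and> Z \<in> N \<rightarrow>\<^sub>M evec \<and> is_GP p l (distr N evec Z) \<longrightarrow>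
             distr N evec Z = distr M evec (\<lambda>\<omega>. add_scalar (S \<omega>) (E \<omega>)))) \<and>
      (\<forall>(M :: 'a measure) S E.
          spectral_exp_pair M S E \<and>
          is_GP p l (distr M evec (\<lambda>\<omega>. add_scalar (S \<omega>) (E \<omega>))) \<longrightarrow>
          distr M evec S = \<nu>)"
proof -
  from assms have p: "\<And>j. 0 < p j" by blast
  obtain \<nu> :: "('n \<Rightarrow> ereal) measure" where \<nu>:
    "prob_space \<nu>" "sets \<nu> = sets evec" "AE s in \<nu>. (MAX j. s j) = 0"
    "\<And>j. \<P>(s in \<nu>. s j > -\<infinity>) > 0"
    "\<And>y. (\<And>j. 0 \<le> y j) \<Longrightarrow> l (\<lambda>j. p j * y j) = (\<integral>s. (MAX j. y j * exp_ereal (s j)) \<partial>\<nu>)"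
    using stdf_spectral_law[OF p assms(2,3)] by blast
  let ?M = "\<nu> \<Otimes>\<^sub>M density lborel (exponential_density 1)"
  let ?S = "\<lambda>(\<omega> :: ('n \<Rightarrow> ereal) \<times> real) j. min (fst \<omega> j) 0"
  have SE: "spectral_exp_pair ?M ?S snd"
    by (rule spectral_exp_pair_product) (fact \<nu>)+
  have GP: "is_GP p l (distr ?M evec (\<lambda>\<omega>. add_scalar (?S \<omega>) (snd \<omega>)))"
    using is_GP_add_exponential[of \<nu> p l, OF \<nu>(1-3) p \<nu>(5)] .
  \<comment> \<open>Both spectral laws are images under the same map of the generalized Pareto law,
    which its distribution function determines.\<close>
  have unique: "distr M evec S = distr ?M evec ?S"
    if "spectral_exp_pair M S E" "is_GP p l (distr M evec (\<lambda>\<omega>. add_scalar (S \<omega>) (E \<omega>)))"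
    for M :: "'a measure" and S :: "'a \<Rightarrow> 'n \<Rightarrow> ereal" and E
    unfolding distr_spectral[OF that(1)] distr_spectral[OF SE] is_GP_unique[OF that(2) GP] ..
  show ?thesis
  proof (intro exI[of _ "distr ?M evec ?S"] exI[of _ ?M] exI[of _ ?S] exI[of _ snd] conjI allI impI)
    fix N :: "'b measure" and Z
    assume "prob_space N \<and> Z \<in> N \<rightarrow>\<^sub>M evec \<and> is_GP p l (distr N evec Z)"
    then show "distr N evec Z = distr ?M evec (\<lambda>\<omega>. add_scalar (?S \<omega>) (snd \<omega>))"
      by (intro is_GP_unique[OF _ GP]) simp
  next
    fix M :: "'a measure" and S :: "'a \<Rightarrow> 'n \<Rightarrow> ereal" and E
    assume "spectral_exp_pair M S E \<and> is_GP p l (distr M evec (\<lambda>\<omega>. add_scalar (S \<omega>) (E \<omega>)))"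
    then show "distr M evec S = distr ?M evec ?S" by (elim conjE) (rule unique)
  qed (fact SE GP refl)+
qed

end
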